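(* Let $(\Omega,\mathcal{F})$ be a measurable space, $\mathcal{G}\subseteq\mathcal{F}$, and let $V$ be any (Hausdorff) topological vector space. Then: 1. Let $\Theta$ be a finitely-additive $V$-valued measure on $(\Omega,\mathcal{F})$. The following two statements are equivalent: (a) There exists a set $G_\Theta\in\mathcal{G}$ such that $G\setminus G_\Theta$ is a $\Theta$-null set for every $G\in\mathcal{G}$. (b) There exist a set $\bar{G}\in\mathcal{G}$ and two finitely-additive $V$-valued measures $\Theta_{\mathcal{G}},\Theta_{\mathcal{G}}^\perp$ on $(\Omega,\mathcal{F})$ such that $\Theta=\Theta_{\mathcal{G}}+\Theta_{\mathcal{G}}^\perp$, $\Theta_{\mathcal{G}}$ is concentrated on $\bar{G}$, and every $G\in\mathcal{G}$ is $\Theta_{\mathcal{G}}^\perp$-null. Moreover, if the equivalent statements (a) and (b) hold then, for any $G_\Theta$ as in (a) and any $\bar{G},\Theta_{\mathcal{G}},\Theta_{\mathcal{G}}^\perp$ as in (b), $G_\Theta$ and $\bar{G}$ are unique up to a $\Theta$-null set, $G_\Theta=\bar{G}$ up to a $\Theta$-null set, $\Theta_{\mathcal{G}}=\Theta(G_\Theta\cap\cdot)$ and $\Theta_{\mathcal{G}}^\perp=\Theta(G_\Theta^c\cap\cdot)$; in particular, such $\Theta_{\mathcal{G}},\Theta_{\mathcal{G}}^\perp$ are unique. 2. If $\Theta$ is a $V$-valued countably-additive measure on $(\Omega,\mathcal{F})$ which admits a control measure $\theta$, and $\mathcal{G}$ is non-empty and closed under countable unions, then there exists a set $G_\Theta\in\mathcal{G}$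 such that $G\setminus G_\Theta$ is a $\Theta$-null set for every $G\in\mathcal{G}$ and, up to $\Theta$-null sets, $G_\Theta$ is unique and equals $G_\theta$, where $G_\theta\in\mathcal{G}$ denotes a set (which exists) such that $G\setminus G_\theta$ is a $\theta$-null set for every $G\in\mathcal{G}$.
   Context: $\mathcal{F}$ is a $\sigma$-algebra on $\Omega$, and $A^c:=\Omega\setminus A$. A finitely-additive $V$-valued measure on $(\Omega,\mathcal{F})$ is a function $\Theta:\mathcal{F}\to V$ such that $\Theta(A\cup B)=\Theta(A)+\Theta(B)$ for all disjoint $A,B\in\mathcal{F}$. It is countably additive if $\Theta(\bigcup_{n=1}^\infty A_n)=\sum_{n=1}^\infty\Theta(A_n)$ for every sequence of pairwise disjoint $A_n\in\mathcal{F}$, where the series denotes the limit in $V$ of the partial sums. For a (positive or vector, finitely or countably additive) measure $\lambda$, a set $F\in\mathcal{F}$ is $\lambda$-null if $\lambda(H)=0$ for all $H\in\mathcal{F}$ with $H\subseteq F$; $\lambda$ is concentrated on $F\in\mathcal{F}$ if $F^c$ is $\lambda$-null. Two sets $F,F'\in\mathcal{F}$ are equal up to a $\lambda$-null set if $F\setminus F'$ and $F'\setminus F$ are $\lambda$-null. A control measure for $\Theta$ is a finite positive (countably-additive) measure $\theta$ on $(\Omega,\mathcal{F})$ such that every $\theta$-null set is a $\Theta$-null set. *)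

theory Defs
  imports "HOL-Analysis.Analysis"
begin

text \<open>
  The scalars range over \<open>real_normed_field\<close>, so that both real and complex topological vector
  spaces are covered. The topology and the (jointly continuous) addition of \<^typ>\<open>'v\<close> come from the
  type classes; the Hausdorff property is \<^class>\<open>t2_space\<close>.
\<close>

locale topological_vector_space = vector_space scale
  for scale :: "'k::real_normed_field \<Rightarrow> 'v::{topological_ab_group_add, t2_space} \<Rightarrow> 'v" +
  assumes continuous_scale: "continuous_on UNIV (\<lambda>(c, v). scale c v)"

text \<open>
  Set functions on a \<open>\<sigma>\<close>-algebra \<open>F\<close> are total functions on sets; only their values on \<open>F\<close> are
  relevant. A finitely additive \<open>V\<close>-valued measure on \<open>F\<close> is a function with the library property
  \<^const>\<open>Measure_Space.additive\<close>.
\<close>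

definition count_additive_measure ::
  "'a set set \<Rightarrow> ('a set \<Rightarrow> 'v::{ab_group_add, topological_space}) \<Rightarrow> bool" where
  "count_additive_measure F \<Theta> \<longleftrightarrow>
     Measure_Space.additive F \<Theta> \<and>
     (\<forall>A :: nat \<Rightarrow> 'a set. range A \<subseteq> F \<longrightarrow> disjoint_family A \<longrightarrow>
        (\<lambda>n. \<Theta> (A n)) sums \<Theta> (\<Union>n. A n))"

text \<open>
  The codomain is only required to have a zero, so that the same notion applies to vector measures
  and, with \<open>\<mu> = emeasure \<theta>\<close>, to positive measures.
\<close>

definition null_set :: "'a set set \<Rightarrow> ('a set \<Rightarrow> 'b::zero) \<Rightarrow> 'a set \<Rightarrow> bool" where
  "null_set F \<mu> N \<longleftrightarrow> N \<in> F \<and> (\<forall>H\<in>F. H \<subseteq> N \<longrightarrow> \<mu> H = 0)"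

definition concentrated_on ::
  "'a set \<Rightarrow> 'a set set \<Rightarrow> ('a set \<Rightarrow> 'b::zero) \<Rightarrow> 'a set \<Rightarrow> bool" where
  "concentrated_on \<Omega> F \<mu> A \<longleftrightarrow> A \<in> F \<and> null_set F \<mu> (\<Omega> - A)"

definition eq_upto_null ::
  "'a set set \<Rightarrow> ('a set \<Rightarrow> 'b::zero) \<Rightarrow> 'a set \<Rightarrow> 'a set \<Rightarrow> bool" where
  "eq_upto_null F \<mu> A B \<longleftrightarrow>
     A \<in> F \<and> B \<in> F \<and> null_set F \<mu> (A - B) \<and> null_set F \<mu> (B - A)"

definition control_measure ::
  "'a set \<Rightarrow> 'a set set \<Rightarrow> ('a set \<Rightarrow> 'v::zero) \<Rightarrow> 'a measure \<Rightarrow> bool" where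
  "control_measure \<Omega> F \<Theta> \<theta> \<longleftrightarrow>
     finite_measure \<theta> \<and> space \<theta> = \<Omega> \<and> sets \<theta> = F \<and>
     (\<forall>N. null_set F (emeasure \<theta>) N \<longrightarrow> null_set F \<Theta> N)"

definition largest_upto_null ::
  "'a set set \<Rightarrow> 'a set set \<Rightarrow> ('a set \<Rightarrow> 'b::zero) \<Rightarrow> 'a set \<Rightarrow> bool" where
  "largest_upto_null F \<G> \<mu> M \<longleftrightarrow> M \<in> \<G> \<and> (\<forall>G\<in>\<G>. null_set F \<mu> (G - M))"

definition measure_decomposition ::
  "'a set \<Rightarrow> 'a set set \<Rightarrow> 'a set set \<Rightarrow> ('a set \<Rightarrow> 'v::ab_group_add) \<Rightarrow>
   'a set \<Rightarrow> ('a set \<Rightarrow> 'v) \<Rightarrow> ('a set \<Rightarrow> 'v) \<Rightarrow> bool" where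
  "measure_decomposition \<Omega> F \<G> \<Theta> B \<Theta>1 \<Theta>2 \<longleftrightarrow>
     B \<in> \<G> \<and> Measure_Space.additive F \<Theta>1 \<and> Measure_Space.additive F \<Theta>2 \<and>
     (\<forall>A\<in>F. \<Theta> A = \<Theta>1 A + \<Theta>2 A) \<and>
     concentrated_on \<Omega> F \<Theta>1 B \<and>
     (\<forall>G\<in>\<G>. null_set F \<Theta>2 G)"

end

theory Submission
  imports Defs
begin

text \<open>
  In a decomposition \<open>\<Theta> = \<Theta>1 + \<Theta>2\<close> as in (b), \<open>\<Theta>2\<close> vanishes inside \<open>B\<close> and \<open>\<Theta>1\<close> vanishes outside
  \<open>B\<close>, so the two summands are forced to be the restrictions of \<open>\<Theta>\<close> to \<open>B\<close> and to its complement;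
  moreover \<open>B\<close> is then a largest element of \<open>\<G>\<close> up to null sets. Two largest elements differ by null
  sets by definition, which gives all uniqueness claims. For a finite positive measure, a largest
  element is obtained as the union of a sequence along which the measure tends to its supremum over
  \<open>\<G>\<close>, and it stays largest for every \<open>\<Theta>\<close> that the measure controls.
\<close>

lemma null_setD: "null_set F \<mu> N \<Longrightarrow> H \<in> F \<Longrightarrow> H \<subseteq> N \<Longrightarrow> \<mu> H = 0"
  unfolding null_set_def by blast

lemma largest_upto_null_unique:
  assumes "\<G> \<subseteq> F" "largest_upto_null F \<G> \<mu> G" "largest_upto_null F \<G> \<mu> G'"
  shows "eq_upto_null F \<mu> G G'"
  using assms unfolding largest_upto_null_def eq_upto_null_def by blast

context sigma_algebra
begin

lemma additive_split:
  assumes "Measure_Space.additive M \<Theta>" "A \<in> M" "B \<in> M"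
  shows "\<Theta> A = \<Theta> (B \<inter> A) + \<Theta> (A - B)"
proof -
  have "B \<inter> A \<in> M" "A - B \<in> M" "(B \<inter> A) \<inter> (A - B) = {}" "A = (B \<inter> A) \<union> (A - B)"
    using assms by auto
  then show ?thesis
    using additiveD[OF assms(1), of "B \<inter> A" "A - B"] by metis
qed

lemma additive_restrict:
  assumes "Measure_Space.additive M \<Theta>" "B \<in> M"
  shows "Measure_Space.additive M (\<lambda>A. \<Theta> (B \<inter> A))"
  unfolding Measure_Space.additive_def
proof (intro ballI impI)
  fix x y assume "x \<in> M" "y \<in> M" "x \<inter> y = {}"
  then have "\<Theta> ((B \<inter> x) \<union> (B \<inter> y)) = \<Theta> (B \<inter> x) + \<Theta> (B \<inter> y)"
    using assms by (intro additiveD[OF assms(1)]) auto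
  then show "\<Theta> (B \<inter> (x \<union> y)) = \<Theta> (B \<inter> x) + \<Theta> (B \<inter> y)"
    by (simp add: Int_Un_distrib)
qed

text \<open>Both values equal \<open>\<Theta> (B \<inter> B' \<inter> A)\<close>: what remains of
  \<open>B \<inter> A\<close> and of \<open>B' \<inter> A\<close> lies in \<open>B - B'\<close> and
  in \<open>B' - B\<close>, where \<open>\<Theta>\<close> vanishes on every measurable
  subset.\<close>

lemma additive_restrict_cong:
  fixes \<Theta> :: "'a set \<Rightarrow> 'v::ab_group_add"
  assumes "Measure_Space.additive M \<Theta>" "eq_upto_null M \<Theta> B B'" "A \<in> M"
  shows "\<Theta> (B \<inter> A) = \<Theta> (B' \<inter> A)"
proof -
  have B: "B \<in> M" "B' \<in> M" "null_set M \<Theta> (B - B')" "null_set M \<Theta> (B' - B)"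
    using assms(2) by (auto simp: eq_upto_null_def)
  have "\<Theta> (B \<inter> A - B') = 0" "\<Theta> (B' \<inter> A - B) = 0"
    using B assms(3) by (auto intro: null_setD[OF B(3)] null_setD[OF B(4)])
  moreover have "\<Theta> (B \<inter> A) = \<Theta> (B' \<inter> (B \<inter> A)) + \<Theta> (B \<inter> A - B')"
      "\<Theta> (B' \<inter> A) = \<Theta> (B \<inter> (B' \<inter> A)) + \<Theta> (B' \<inter> A - B)"
    using B assms by (auto intro!: additive_split)
  ultimately show ?thesis
    by (simp add: Int_left_commute)
qed

lemma measure_decomposition_unique:
  fixes \<Theta> :: "'a set \<Rightarrow> 'v::ab_group_add"
  assumes "\<G> \<subseteq> M" "measure_decomposition \<Omega> M \<G> \<Theta> B \<Theta>1 \<Theta>2" "A \<in> M"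
  shows "\<Theta>1 A = \<Theta> (B \<inter> A)" and "\<Theta>2 A = \<Theta> ((\<Omega> - B) \<inter> A)"
proof -
  have d: "B \<in> M" "Measure_Space.additive M \<Theta>1" "Measure_Space.additive M \<Theta>2"
      "\<And>A. A \<in> M \<Longrightarrow> \<Theta> A = \<Theta>1 A + \<Theta>2 A"
      "null_set M \<Theta>1 (\<Omega> - B)" "null_set M \<Theta>2 B"
    using assms(1,2) by (auto simp: measure_decomposition_def concentrated_on_def)
  have eq: "A - B = (\<Omega> - B) \<inter> A"
    using sets_into_space[OF assms(3)] by auto
  \<comment> \<open>\<open>A - B\<close> lies in \<open>\<Omega> - B\<close>, and \<open>B\<close>,
    being a member of \<open>\<G>\<close>, is itself \<open>\<Theta>2\<close>-null.\<close>
  have "\<Theta>1 (A - B) = 0" "\<Theta>2 (B \<inter> A) = 0"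
    using d(1) assms(3) sets_into_space[OF assms(3)]
    by (auto intro!: null_setD[OF d(5)] null_setD[OF d(6)])
  moreover have "\<Theta> (B \<inter> A) = \<Theta>1 (B \<inter> A) + \<Theta>2 (B \<inter> A)" "\<Theta> (A - B) = \<Theta>1 (A - B) + \<Theta>2 (A - B)"
    using d(1) assms(3) by (auto intro!: d(4))
  \<comment> \<open>Splitting \<open>\<Theta>1 A\<close> and \<open>\<Theta>2 A\<close> along
    \<open>B\<close> leaves one surviving term each, and on that piece the summand agrees with
    \<open>\<Theta>\<close>.\<close>
  ultimately show "\<Theta>1 A = \<Theta> (B \<inter> A)" "\<Theta>2 A = \<Theta> ((\<Omega> - B) \<inter> A)"
    using additive_split[OF d(2) assms(3) d(1)] additive_split[OF d(3) assms(3) d(1)]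
    by (simp_all add: eq)
qed

text \<open>A measurable subset of \<open>G - B\<close> avoids \<open>B\<close>, which kills
  \<open>\<Theta>1\<close>, and lies in \<open>G\<close>, which kills
  \<open>\<Theta>2\<close>.\<close>

lemma largest_upto_null_of_decomposition:
  fixes \<Theta> :: "'a set \<Rightarrow> 'v::ab_group_add"
  assumes "\<G> \<subseteq> M" "measure_decomposition \<Omega> M \<G> \<Theta> B \<Theta>1 \<Theta>2"
  shows "largest_upto_null M \<G> \<Theta> B"
  unfolding largest_upto_null_def null_set_def
proof (intro conjI ballI impI)
  have d: "B \<in> \<G>" "\<And>A. A \<in> M \<Longrightarrow> \<Theta> A = \<Theta>1 A + \<Theta>2 A" "null_set M \<Theta>1 (\<Omega> - B)"
      "\<And>G. G \<in> \<G> \<Longrightarrow> null_set M \<Theta>2 G"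
    using assms(2) by (auto simp: measure_decomposition_def concentrated_on_def)
  show "B \<in> \<G>" by (rule d)
  fix G assume G: "G \<in> \<G>"
  then show "G - B \<in> M" using assms(1) d(1) by auto
  fix H assume H: "H \<in> M" "H \<subseteq> G - B"
  have "\<Theta>1 H = 0"
    using H sets_into_space[OF H(1)] by (intro null_setD[OF d(3)]) auto
  moreover have "\<Theta>2 H = 0"
    using H by (intro null_setD[OF d(4)[OF G]]) auto
  ultimately show "\<Theta> H = 0" using d(2)[OF H(1)] by simp
qed

text \<open>This supplies the witnesses for (b). The second summand vanishes inside each
  \<open>G\<close> in \<open>\<G>\<close> because it evaluates \<open>\<Theta>\<close> only on
  subsets of the null set \<open>G - B\<close>.\<close>

lemma decomposition_of_largest_upto_null:
  fixes \<Theta> :: "'a set \<Rightarrow> 'v::ab_group_add"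
  assumes "\<G> \<subseteq> M" "Measure_Space.additive M \<Theta>" "largest_upto_null M \<G> \<Theta> B"
  shows "measure_decomposition \<Omega> M \<G> \<Theta> B (\<lambda>A. \<Theta> (B \<inter> A)) (\<lambda>A. \<Theta> ((\<Omega> - B) \<inter> A))"
proof -
  have BG: "B \<in> \<G>" and BM: "B \<in> M" and null: "\<And>G. G \<in> \<G> \<Longrightarrow> null_set M \<Theta> (G - B)"
    using assms by (auto simp: largest_upto_null_def)
  \<comment> \<open>Cancel in \<open>\<Theta> {} = \<Theta> {} + \<Theta> {}\<close>. This is the
    value that the first summand takes on every set disjoint from \<open>B\<close>.\<close>
  have zero: "\<Theta> {} = 0"
    using additiveD[OF assms(2), of "{}" "{}"] by simp
  have split: "\<Theta> A = \<Theta> (B \<inter> A) + \<Theta> ((\<Omega> - B) \<inter> A)" if "A \<in> M" for A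
  proof -
    have "A - B = (\<Omega> - B) \<inter> A" using sets_into_space[OF that] by auto
    then show ?thesis using additive_split[OF assms(2) that BM] by simp
  qed
  have "\<Theta> (B \<inter> H) = 0" if "H \<subseteq> \<Omega> - B" for H
  proof -
    have "B \<inter> H = {}" using that by auto
    then show ?thesis using zero by simp
  qed
  then have "concentrated_on \<Omega> M (\<lambda>A. \<Theta> (B \<inter> A)) B"
    using BM by (auto simp: concentrated_on_def null_set_def)
  moreover have "null_set M (\<lambda>A. \<Theta> ((\<Omega> - B) \<inter> A)) G" if "G \<in> \<G>" for G
    unfolding null_set_def
  proof (intro conjI ballI impI)
    show "G \<in> M" using that assms(1) by auto
    fix H assume "H \<in> M" "H \<subseteq> G"
    then show "\<Theta> ((\<Omega> - B) \<inter> H) = 0"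
      using BM by (intro null_setD[OF null[OF that]]) auto
  qed
  ultimately show ?thesis
    using BG BM split additive_restrict[OF assms(2) BM] additive_restrict[OF assms(2) compl_sets[OF BM]]
    by (simp add: measure_decomposition_def)
qed

end

text \<open>The supremum of the measure over \<open>\<G>\<close> is attained at some
  \<open>B\<close>. If \<open>G - B\<close> had positive measure, then \<open>B \<union> G\<close>,
  again in \<open>\<G>\<close>, would exceed that supremum, since \<open>B\<close> has finite
  measure.\<close>

lemma (in finite_measure) ex_largest_upto_null_emeasure:
  assumes sub: "\<G> \<subseteq> sets M" and ne: "\<G> \<noteq> {}"
    and UN: "\<And>A :: nat \<Rightarrow> 'a set. range A \<subseteq> \<G> \<Longrightarrow> (\<Union>n. A n) \<in> \<G>"
  shows "\<exists>G. largest_upto_null (sets M) \<G> (emeasure M) G"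
proof -
  \<comment> \<open>A supremum of a non-empty set of extended nonnegative reals is the supremum of
    countably many of its elements; the sets \<open>A n\<close> below realise these values.\<close>
  obtain f :: "nat \<Rightarrow> ennreal" where f: "range f \<subseteq> emeasure M ` \<G>" "Sup (emeasure M ` \<G>) = Sup (range f)"
    using ennreal_Sup_countable_SUP[of "emeasure M ` \<G>"] ne by auto
  then have "\<forall>n. \<exists>G\<in>\<G>. f n = emeasure M G" by auto
  then obtain A where A: "\<And>n. A n \<in> \<G>" "\<And>n. f n = emeasure M (A n)" by metis
  define B where "B = (\<Union>n. A n)"
  have B: "B \<in> \<G>" unfolding B_def using A(1) by (intro UN) auto
  \<comment> \<open>\<open>B\<close> contains every \<open>A n\<close>, so its measure dominates all
    \<open>f n\<close> and with them the supremum over \<open>\<G>\<close>.\<close>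
  have ub: "emeasure M G \<le> emeasure M B" if "G \<in> \<G>" for G
  proof -
    have "emeasure M G \<le> Sup (range f)" using that f(2) by (metis SUP_upper)
    also have "\<dots> \<le> emeasure M B"
      using B sub by (intro SUP_least) (auto simp: A(2) B_def intro!: emeasure_mono)
    finally show ?thesis .
  qed
  have "null_set (sets M) (emeasure M) (G - B)" if G: "G \<in> \<G>" for G
    unfolding null_set_def
  proof (intro conjI ballI impI)
    have s: "G \<in> sets M" "B \<in> sets M" using G B sub by auto
    then show "G - B \<in> sets M" by auto
    \<comment> \<open>Closure under binary unions follows from the countable case through the
      sequence \<open>G, B, B, ...\<close>.\<close>
    have "(\<Union>n::nat. if n = 0 then G else B) \<in> \<G>" using G B by (intro UN) auto
    moreover have "(\<Union>n::nat. if n = 0 then G else B) = B \<union> (G - B)" by (auto split: if_splits)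
    ultimately have "B \<union> (G - B) \<in> \<G>" by simp
    \<comment> \<open>Maximality of \<open>B\<close> is tested on the disjoint union of
      \<open>B\<close> and \<open>G - B\<close>. The summand \<open>0\<close> prepares the
      cancellation of \<open>emeasure M B\<close>, which is legitimate because that value is
      finite.\<close>
    from ub[OF this] have "emeasure M B + emeasure M (G - B) \<le> emeasure M B + 0"
      using s by (subst plus_emeasure) auto
    then have 0: "emeasure M (G - B) = 0"
      by (simp add: ennreal_add_left_cancel_le)
    fix H assume "H \<in> sets M" "H \<subseteq> G - B"
    then have "emeasure M H \<le> emeasure M (G - B)" using s by (intro emeasure_mono) auto
    then show "emeasure M H = 0" using 0 by simp
  qed
  then show ?thesis using B by (auto simp: largest_upto_null_def)
qed

theorem theorem4p2:
  fixes \<Omega> :: "'a set" and F \<G> :: "'a set set"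
    and scale :: "'k::real_normed_field \<Rightarrow> 'v::{topological_ab_group_add, t2_space} \<Rightarrow> 'v"
  assumes "sigma_algebra \<Omega> F"
    and "\<G> \<subseteq> F"
    and "topological_vector_space scale"
  shows
    "(\<forall>\<Theta> :: 'a set \<Rightarrow> 'v. Measure_Space.additive F \<Theta> \<longrightarrow>
        ((\<exists>G\<Theta>. largest_upto_null F \<G> \<Theta> G\<Theta>) \<longleftrightarrow>
         (\<exists>B \<Theta>1 \<Theta>2. measure_decomposition \<Omega> F \<G> \<Theta> B \<Theta>1 \<Theta>2)) \<and>
        (\<forall>G G'. largest_upto_null F \<G> \<Theta> G \<and> largest_upto_null F \<G> \<Theta> G' \<longrightarrow>
           eq_upto_null F \<Theta> G G') \<and>
        (\<forall>B \<Theta>1 \<Theta>2 B' \<Theta>1' \<Theta>2'.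
           measure_decomposition \<Omega> F \<G> \<Theta> B \<Theta>1 \<Theta>2 \<and>
           measure_decomposition \<Omega> F \<G> \<Theta> B' \<Theta>1' \<Theta>2' \<longrightarrow>
           eq_upto_null F \<Theta> B B' \<and> (\<forall>A\<in>F. \<Theta>1 A = \<Theta>1' A \<and> \<Theta>2 A = \<Theta>2' A)) \<and>
        (\<forall>G\<Theta> B \<Theta>1 \<Theta>2.
           largest_upto_null F \<G> \<Theta> G\<Theta> \<and> measure_decomposition \<Omega> F \<G> \<Theta> B \<Theta>1 \<Theta>2 \<longrightarrow>
           eq_upto_null F \<Theta> G\<Theta> B \<and>
           (\<forall>A\<in>F. \<Theta>1 A = \<Theta> (G\<Theta> \<inter> A) \<and> \<Theta>2 A = \<Theta> ((\<Omega> - G\<Theta>) \<inter> A))))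
     \<and>
     (\<forall>(\<Theta> :: 'a set \<Rightarrow> 'v) (\<theta> :: 'a measure).
        count_additive_measure F \<Theta> \<and> control_measure \<Omega> F \<Theta> \<theta> \<and> \<G> \<noteq> {} \<and>
        (\<forall>A :: nat \<Rightarrow> 'a set. range A \<subseteq> \<G> \<longrightarrow> (\<Union>n. A n) \<in> \<G>) \<longrightarrow>
        (\<exists>G\<Theta>. largest_upto_null F \<G> \<Theta> G\<Theta>) \<and>
        (\<exists>G\<theta>. largest_upto_null F \<G> (emeasure \<theta>) G\<theta>) \<and>
        (\<forall>G G'. largest_upto_null F \<G> \<Theta> G \<and> largest_upto_null F \<G> \<Theta> G' \<longrightarrow>
           eq_upto_null F \<Theta> G G') \<and>
        (\<forall>G\<Theta> G\<theta>. largest_upto_null F \<G> \<Theta> G\<Theta> \<and> largest_upto_null F \<G> (emeasure \<theta>) G\<theta> \<longrightarrow>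
           eq_upto_null F \<Theta> G\<Theta> G\<theta>))"
proof (intro conjI allI impI)
  interpret sigma_algebra \<Omega> F by fact
  note sub = \<open>\<G> \<subseteq> F\<close>
  note unique = largest_upto_null_unique[OF sub]
  note largest = largest_upto_null_of_decomposition[OF sub]
  note restrict = measure_decomposition_unique[OF sub]
  {
    fix \<Theta> :: "'a set \<Rightarrow> 'v"
    assume add: "Measure_Space.additive F \<Theta>"
    \<comment> \<open>Taking complements merely swaps the differences \<open>C - C'\<close> and
      \<open>C' - C\<close>, so equality up to null sets is preserved and the congruence lemma
      applies to the complements.\<close>
    have compl: "\<Theta> ((\<Omega> - C) \<inter> A) = \<Theta> ((\<Omega> - C') \<inter> A)"
      if "eq_upto_null F \<Theta> C C'" "A \<in> F" for C C' A
    proof -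
      have "C \<in> F" "C' \<in> F" using that(1) by (auto simp: eq_upto_null_def)
      then have "(\<Omega> - C) - (\<Omega> - C') = C' - C" "(\<Omega> - C') - (\<Omega> - C) = C - C'"
        using sets_into_space by blast+
      then have "eq_upto_null F \<Theta> (\<Omega> - C) (\<Omega> - C')"
        using that(1) by (auto simp: eq_upto_null_def)
      then show ?thesis using add that(2) by (intro additive_restrict_cong)
    qed
    show "(\<exists>G\<Theta>. largest_upto_null F \<G> \<Theta> G\<Theta>) \<longleftrightarrow>
        (\<exists>B \<Theta>1 \<Theta>2. measure_decomposition \<Omega> F \<G> \<Theta> B \<Theta>1 \<Theta>2)"
      using decomposition_of_largest_upto_null[OF sub add] largest by blast
    show "eq_upto_null F \<Theta> G G'"
      if "largest_upto_null F \<G> \<Theta> G \<and> largest_upto_null F \<G> \<Theta> G'" for G G'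
      using that unique by blast
    have mixed: "eq_upto_null F \<Theta> G B \<and>
        (\<forall>A\<in>F. \<Theta>1 A = \<Theta> (G \<inter> A) \<and> \<Theta>2 A = \<Theta> ((\<Omega> - G) \<inter> A))"
      if "largest_upto_null F \<G> \<Theta> G \<and> measure_decomposition \<Omega> F \<G> \<Theta> B \<Theta>1 \<Theta>2" for G B \<Theta>1 \<Theta>2
    proof -
      have "eq_upto_null F \<Theta> G B" using that unique largest by blast
      \<comment> \<open>The summands are first expressed through \<open>B\<close>; the two
        congruences then replace \<open>B\<close> by \<open>G\<close>.\<close>
      then show ?thesis
        using that restrict additive_restrict_cong[OF add] compl by metis
    qed
    then show "eq_upto_null F \<Theta> G B"
        "\<forall>A\<in>F. \<Theta>1 A = \<Theta> (G \<inter> A) \<and> \<Theta>2 A = \<Theta> ((\<Omega> - G) \<inter> A)"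
      if "largest_upto_null F \<G> \<Theta> G \<and> measure_decomposition \<Omega> F \<G> \<Theta> B \<Theta>1 \<Theta>2" for G B \<Theta>1 \<Theta>2
      using that by blast+
    show "eq_upto_null F \<Theta> B B'" "\<forall>A\<in>F. \<Theta>1 A = \<Theta>1' A \<and> \<Theta>2 A = \<Theta>2' A"
      if "measure_decomposition \<Omega> F \<G> \<Theta> B \<Theta>1 \<Theta>2 \<and> measure_decomposition \<Omega> F \<G> \<Theta> B' \<Theta>1' \<Theta>2'"
      for B \<Theta>1 \<Theta>2 B' \<Theta>1' \<Theta>2'
      \<comment> \<open>\<open>B\<close> is itself a largest set, so \<open>mixed\<close> expresses
        the primed summands as restrictions of \<open>\<Theta>\<close> to \<open>B\<close> and its
        complement; the unprimed ones are the same restrictions.\<close>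
      using mixed[of B B' \<Theta>1' \<Theta>2'] that largest[of \<Theta> B \<Theta>1 \<Theta>2] restrict[of \<Theta> B \<Theta>1 \<Theta>2] by simp_all
  next
    fix \<Theta> :: "'a set \<Rightarrow> 'v" and \<theta> :: "'a measure"
    assume *: "count_additive_measure F \<Theta> \<and> control_measure \<Omega> F \<Theta> \<theta> \<and> \<G> \<noteq> {} \<and>
        (\<forall>A :: nat \<Rightarrow> 'a set. range A \<subseteq> \<G> \<longrightarrow> (\<Union>n. A n) \<in> \<G>)"
    then have \<theta>: "finite_measure \<theta>" "sets \<theta> = F"
      and null: "\<And>N. null_set F (emeasure \<theta>) N \<Longrightarrow> null_set F \<Theta> N"
      by (auto simp: control_measure_def)
    show ex: "\<exists>G. largest_upto_null F \<G> (emeasure \<theta>) G"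
      using finite_measure.ex_largest_upto_null_emeasure[OF \<theta>(1), of \<G>] \<theta>(2) sub * by auto
    \<comment> \<open>Each \<open>G' - G\<close> with \<open>G'\<close> in \<open>\<G>\<close> is
      null for \<open>\<theta>\<close> and hence for \<open>\<Theta>\<close>. Thus comparing
      \<open>G\<Theta>\<close> with \<open>G\<theta>\<close> becomes a case of uniqueness for
      \<open>\<Theta>\<close> alone.\<close>
    have control: "largest_upto_null F \<G> \<Theta> G" if "largest_upto_null F \<G> (emeasure \<theta>) G" for G
      using that null by (auto simp: largest_upto_null_def)
    then show "\<exists>G. largest_upto_null F \<G> \<Theta> G" using ex by blast
    show "eq_upto_null F \<Theta> G G'"
      if "largest_upto_null F \<G> \<Theta> G \<and> largest_upto_null F \<G> \<Theta> G'" for G G'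
      using that unique by blast
    show "eq_upto_null F \<Theta> G G'"
      if "largest_upto_null F \<G> \<Theta> G \<and> largest_upto_null F \<G> (emeasure \<theta>) G'" for G G'
      using that unique control by blast
  }
qed

end
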